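(* Let $p>3$ be a prime and let $G$ be an abelian group of order dividing $p^5$. Then \[ G\otimes G\cong \begin{cases} \mathbb{Z}_{p^5} & \text{if } G\cong G_1,\\ \mathbb{Z}_{p^3}\oplus\mathbb{Z}_{p^2}^{(3)} & \text{if } G\cong G_{13},\\ \mathbb{Z}_{p^4}\oplus\mathbb{Z}_{p}^{(3)} & \text{if } G\cong G_{26},\\ \mathbb{Z}_{p^2}^{(4)}\oplus\mathbb{Z}_{p}^{(5)} & \text{if } G\cong G_{43},\\ \mathbb{Z}_{p^3}\oplus\mathbb{Z}_{p}^{(8)} & \text{if } G\cong G_{51},\\ \mathbb{Z}_{p^2}\oplus\mathbb{Z}_{p}^{(15)} & \text{if } G\cong G_{66},\\ \mathbb{Z}_{p}^{(25)} & \text{if } G\cong G_{70}. \end{cases} \]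
   Context: Notation: $\mathbb{Z}_n$ is the cyclic group of order $n$, and $A^{(n)}$ is the direct sum of $n$ copies of $A$. The groups are $G_1\cong\mathbb{Z}_{p^5}$, $G_{13}\cong\mathbb{Z}_{p^3}\times\mathbb{Z}_{p^2}$, $G_{26}\cong\mathbb{Z}_{p^4}\times\mathbb{Z}_p$, $G_{43}\cong\mathbb{Z}_{p^2}\times\mathbb{Z}_{p^2}\times\mathbb{Z}_p$, $G_{51}\cong\mathbb{Z}_{p^3}\times\mathbb{Z}_p\times\mathbb{Z}_p$, $G_{66}\cong\mathbb{Z}_{p^2}\times\mathbb{Z}_p\times\mathbb{Z}_p\times\mathbb{Z}_p$, $G_{70}\cong\mathbb{Z}_p^{(5)}$. For a group $G$ write ${}^{g}g'=gg'g^{-1}$. The non-abelian tensor square $G\otimes G$ is the group generated by symbols $g\otimes h$ ($g,h\in G$) subject to $gg'\otimes h=({}^{g}g'\otimes{}^{g}h)(g\otimes h)$ and $g\otimes hh'=(g\otimes h)({}^{h}g\otimes{}^{h}h')$ for all $g,g',h,h'\in G$. *)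

theory Defs
  imports "HOL-Algebra.Product_Groups" "HOL-Computational_Algebra.Primes"
begin

text \<open>
  A word over \<open>S\<close> is a list of letters \<open>(x, b)\<close> with \<open>x \<in> S\<close>; \<open>(x, True)\<close> stands for the
  generator \<open>x\<close> and \<open>(x, False)\<close> for its formal inverse. A relation is a pair \<open>(u, v)\<close> of words,
  read as \<open>u = v\<close>.
\<close>

type_synonym 'x word = "('x \<times> bool) list"

definition words :: "'x set \<Rightarrow> 'x word set" where
  "words S = lists (S \<times> UNIV)"

inductive_set word_cong :: "'x set \<Rightarrow> ('x word \<times> 'x word) set \<Rightarrow> ('x word \<times> 'x word) set"
  for S :: "'x set" and R :: "('x word \<times> 'x word) set" where
  refl: "u \<in> words S \<Longrightarrow> (u, u) \<in> word_cong S R"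
| sym: "(u, v) \<in> word_cong S R \<Longrightarrow> (v, u) \<in> word_cong S R"
| trans: "(u, v) \<in> word_cong S R \<Longrightarrow> (v, w) \<in> word_cong S R \<Longrightarrow> (u, w) \<in> word_cong S R"
| append: "(u, v) \<in> word_cong S R \<Longrightarrow> (u', v') \<in> word_cong S R \<Longrightarrow>
    (u @ u', v @ v') \<in> word_cong S R"
| cancel: "x \<in> S \<Longrightarrow> ([(x, b), (x, \<not> b)], []) \<in> word_cong S R"
| rel: "(u, v) \<in> R \<Longrightarrow> u \<in> words S \<Longrightarrow> v \<in> words S \<Longrightarrow> (u, v) \<in> word_cong S R"

definition presented_group :: "'x set \<Rightarrow> ('x word \<times> 'x word) set \<Rightarrow> 'x word set monoid" where
  "presented_group S R =
     \<lparr>carrier = words S // word_cong S R,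
      monoid.mult = (\<lambda>A B. \<Union>u\<in>A. \<Union>v\<in>B. word_cong S R `` {u @ v}),
      one = word_cong S R `` {[]}\<rparr>"

lemma words_Nil [simp]: "[] \<in> words S"
  by (simp add: words_def)

lemma words_Cons [simp]: "a # u \<in> words S \<longleftrightarrow> fst a \<in> S \<and> u \<in> words S"
  by (cases a) (simp add: words_def)

lemma words_append [simp]: "u @ v \<in> words S \<longleftrightarrow> u \<in> words S \<and> v \<in> words S"
  by (auto simp: words_def)

lemma word_cong_words: "(u, v) \<in> word_cong S R \<Longrightarrow> u \<in> words S \<and> v \<in> words S"
  by (induction rule: word_cong.induct) auto

lemma equiv_word_cong: "equiv (words S) (word_cong S R)"
proof (rule equivI)
  show "word_cong S R \<subseteq> words S \<times> words S"
    using word_cong_words by auto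
  show "refl_on (words S) (word_cong S R)"
    by (rule refl_onI) (rule word_cong.refl)
  show "sym (word_cong S R)"
    by (rule symI) (rule word_cong.sym)
  show "trans (word_cong S R)"
    by (rule transI) (rule word_cong.trans)
qed

lemma mult_presented_group:
  assumes "u \<in> words S" "v \<in> words S"
  shows "word_cong S R `` {u} \<otimes>\<^bsub>presented_group S R\<^esub> word_cong S R `` {v} = word_cong S R `` {u @ v}"
proof -
  have "word_cong S R `` {u' @ v'} = word_cong S R `` {u @ v}"
    if "(u, u') \<in> word_cong S R" "(v, v') \<in> word_cong S R" for u' v'
    using equiv_class_eq[OF equiv_word_cong word_cong.append[OF that]] by simp
  then have "(\<Union>u'\<in>word_cong S R `` {u}. \<Union>v'\<in>word_cong S R `` {v}. word_cong S R `` {u' @ v'}) =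
      (\<Union>u'\<in>word_cong S R `` {u}. \<Union>v'\<in>word_cong S R `` {v}. word_cong S R `` {u @ v})"
    by (intro SUP_cong) auto
  also have "\<dots> = word_cong S R `` {u @ v}"
    using word_cong.refl[OF assms(1), of R] word_cong.refl[OF assms(2), of R]
    by (subst UN_constant, subst UN_constant) auto
  finally show ?thesis
    by (simp add: presented_group_def)
qed

lemma carrier_presented_groupE:
  assumes "A \<in> carrier (presented_group S R)"
  obtains u where "u \<in> words S" "A = word_cong S R `` {u}"
  using assms by (auto simp: presented_group_def elim: quotientE)

lemma carrier_presented_groupI:
  "u \<in> words S \<Longrightarrow> word_cong S R `` {u} \<in> carrier (presented_group S R)"
  by (simp add: presented_group_def quotientI)

definition word_inv :: "'x word \<Rightarrow> 'x word" where
  "word_inv u = rev (map (\<lambda>(x, b). (x, \<not> b)) u)"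

lemma word_inv_words: "u \<in> words S \<Longrightarrow> word_inv u \<in> words S"
  by (induction u) (auto simp: word_inv_def)

lemma word_inv_cancel: "u \<in> words S \<Longrightarrow> (word_inv u @ u, []) \<in> word_cong S R"
proof (induction u)
  case Nil
  then show ?case
    by (simp add: word_inv_def word_cong.refl)
next
  case (Cons a u)
  obtain x b where a: "a = (x, b)"
    by (cases a)
  have u: "u \<in> words S" and x: "x \<in> S"
    using Cons.prems a by auto
  have "([(x, \<not> b), (x, b)], []) \<in> word_cong S R"
    using word_cong.cancel[OF x, of "\<not> b"] by simp
  then have "([(x, \<not> b), (x, b)] @ u, [] @ u) \<in> word_cong S R"
    by (rule word_cong.append) (rule word_cong.refl[OF u])
  then have "(word_inv u @ ([(x, \<not> b), (x, b)] @ u), word_inv u @ ([] @ u)) \<in> word_cong S R"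
    by (rule word_cong.append[OF word_cong.refl[OF word_inv_words[OF u]]])
  then have "(word_inv (a # u) @ a # u, word_inv u @ u) \<in> word_cong S R"
    by (simp add: word_inv_def a)
  then show ?case
    using Cons.IH[OF u] by (rule word_cong.trans)
qed

lemma group_presented_group: "group (presented_group S R)"
proof (rule groupI)
  show "\<one>\<^bsub>presented_group S R\<^esub> \<in> carrier (presented_group S R)"
    by (simp add: presented_group_def quotientI)
next
  fix A B
  assume "A \<in> carrier (presented_group S R)" "B \<in> carrier (presented_group S R)"
  then show "A \<otimes>\<^bsub>presented_group S R\<^esub> B \<in> carrier (presented_group S R)"
    by (auto elim!: carrier_presented_groupE simp: mult_presented_group carrier_presented_groupI)
next
  fix A B C
  assume "A \<in> carrier (presented_group S R)" "B \<in> carrier (presented_group S R)"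
    "C \<in> carrier (presented_group S R)"
  then show "A \<otimes>\<^bsub>presented_group S R\<^esub> B \<otimes>\<^bsub>presented_group S R\<^esub> C =
      A \<otimes>\<^bsub>presented_group S R\<^esub> (B \<otimes>\<^bsub>presented_group S R\<^esub> C)"
    by (auto elim!: carrier_presented_groupE simp: mult_presented_group)
next
  fix A
  assume "A \<in> carrier (presented_group S R)"
  then obtain u where u: "u \<in> words S" "A = word_cong S R `` {u}"
    by (rule carrier_presented_groupE)
  have one: "\<one>\<^bsub>presented_group S R\<^esub> = word_cong S R `` {[]}"
    by (simp add: presented_group_def)
  show "\<one>\<^bsub>presented_group S R\<^esub> \<otimes>\<^bsub>presented_group S R\<^esub> A = A"
    unfolding one u(2) by (simp add: mult_presented_group u(1))
  show "\<exists>B\<in>carrier (presented_group S R). B \<otimes>\<^bsub>presented_group S R\<^esub> A = \<one>\<^bsub>presented_group S R\<^esub>"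
  proof
    show "word_cong S R `` {word_inv u} \<in> carrier (presented_group S R)"
      using u(1) by (intro carrier_presented_groupI word_inv_words)
    show "word_cong S R `` {word_inv u} \<otimes>\<^bsub>presented_group S R\<^esub> A = \<one>\<^bsub>presented_group S R\<^esub>"
      unfolding one u(2) mult_presented_group[OF word_inv_words[OF u(1)] u(1)]
      by (rule equiv_class_eq[OF equiv_word_cong word_inv_cancel[OF u(1)]])
  qed
qed

fun word_eval :: "('h, 'm) monoid_scheme \<Rightarrow> ('x \<Rightarrow> 'h) \<Rightarrow> 'x word \<Rightarrow> 'h" where
  "word_eval H f [] = \<one>\<^bsub>H\<^esub>"
| "word_eval H f ((x, b) # u) = (if b then f x else inv\<^bsub>H\<^esub> f x) \<otimes>\<^bsub>H\<^esub> word_eval H f u"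

lemma word_eval_closed:
  assumes "group H" "f \<in> S \<rightarrow> carrier H" "u \<in> words S"
  shows "word_eval H f u \<in> carrier H"
proof -
  interpret H: group H by fact
  show ?thesis
    using assms(3)
  proof (induction u)
    case (Cons a u)
    obtain x b where a: "a = (x, b)"
      by (cases a)
    have "f x \<in> carrier H" "u \<in> words S"
      using Cons.prems a assms(2) by auto
    then show ?case
      using Cons.IH by (simp add: a)
  qed simp
qed

lemma word_eval_append:
  assumes "group H" "f \<in> S \<rightarrow> carrier H" "u \<in> words S" "v \<in> words S"
  shows "word_eval H f (u @ v) = word_eval H f u \<otimes>\<^bsub>H\<^esub> word_eval H f v"
proof -
  interpret H: group H by fact
  show ?thesis
    using assms(3)
  proof (induction u)
    case Nil
    then show ?case
      using word_eval_closed[OF assms(1,2,4)] by simp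
  next
    case (Cons a u)
    obtain x b where a: "a = (x, b)"
      by (cases a)
    have "f x \<in> carrier H" "u \<in> words S"
      using Cons.prems a assms(2) by auto
    then show ?case
      using Cons.IH word_eval_closed[OF assms(1,2,4)] word_eval_closed[OF assms(1,2), of u]
      by (simp add: a H.m_assoc)
  qed
qed

lemma word_eval_cong:
  assumes "group H" "f \<in> S \<rightarrow> carrier H"
    and "\<And>u v. (u, v) \<in> R \<Longrightarrow> u \<in> words S \<Longrightarrow> v \<in> words S \<Longrightarrow> word_eval H f u = word_eval H f v"
    and "(u, v) \<in> word_cong S R"
  shows "word_eval H f u = word_eval H f v"
proof -
  interpret H: group H by fact
  show ?thesis
    using assms(4)
  proof (induction rule: word_cong.induct)
    case (append u v u' v')
    then show ?case
      using word_cong_words word_eval_append[OF assms(1,2)] by metis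
  next
    case (cancel x b)
    then have "f x \<in> carrier H"
      using assms(2) by auto
    then show ?case
      by simp
  qed (simp_all add: assms(3))
qed

lemma presented_group_lift:
  assumes "group H" "f \<in> S \<rightarrow> carrier H"
    and "\<And>u v. (u, v) \<in> R \<Longrightarrow> u \<in> words S \<Longrightarrow> v \<in> words S \<Longrightarrow> word_eval H f u = word_eval H f v"
  shows "\<exists>\<phi>\<in>hom (presented_group S R) H. \<forall>x\<in>S. \<phi> (word_cong S R `` {[(x, True)]}) = f x"
proof -
  interpret H: group H by fact
  define \<phi> where "\<phi> A = word_eval H f (SOME u. u \<in> A)" for A
  have \<phi>: "\<phi> (word_cong S R `` {u}) = word_eval H f u" if "u \<in> words S" for u
  proof -
    have "(SOME v. v \<in> word_cong S R `` {u}) \<in> word_cong S R `` {u}"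
      by (rule someI[of _ u]) (simp add: word_cong.refl that)
    then show ?thesis
      unfolding \<phi>_def using word_eval_cong[OF assms] by (metis Image_singleton_iff)
  qed
  have "\<phi> \<in> hom (presented_group S R) H"
  proof (rule homI)
    fix A B
    assume A: "A \<in> carrier (presented_group S R)" and B: "B \<in> carrier (presented_group S R)"
    then show "\<phi> A \<in> carrier H"
      using word_eval_closed[OF assms(1,2)] by (auto elim!: carrier_presented_groupE simp: \<phi>)
    show "\<phi> (A \<otimes>\<^bsub>presented_group S R\<^esub> B) = \<phi> A \<otimes>\<^bsub>H\<^esub> \<phi> B"
      using A B
      by (auto elim!: carrier_presented_groupE
          simp: \<phi> mult_presented_group word_eval_append[OF assms(1,2)])
  qed
  moreover have "\<phi> (word_cong S R `` {[(x, True)]}) = f x" if "x \<in> S" for x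
    using that H.r_one[OF funcset_mem[OF assms(2) that]] by (simp add: \<phi>)
  ultimately show ?thesis
    by blast
qed

definition conj_act :: "('a, 'b) monoid_scheme \<Rightarrow> 'a \<Rightarrow> 'a \<Rightarrow> 'a" where
  "conj_act G g h = g \<otimes>\<^bsub>G\<^esub> h \<otimes>\<^bsub>G\<^esub> inv\<^bsub>G\<^esub> g"

abbreviation tensor_letter :: "'a \<Rightarrow> 'a \<Rightarrow> ('a \<times> 'a) \<times> bool" where
  "tensor_letter g h \<equiv> ((g, h), True)"

definition tensor_square_rels ::
  "('a, 'b) monoid_scheme \<Rightarrow> (('a \<times> 'a) word \<times> ('a \<times> 'a) word) set" where
  "tensor_square_rels G =
     {([tensor_letter (g \<otimes>\<^bsub>G\<^esub> g') h],
       [tensor_letter (conj_act G g g') (conj_act G g h), tensor_letter g h]) | g g' h.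
        g \<in> carrier G \<and> g' \<in> carrier G \<and> h \<in> carrier G}
   \<union> {([tensor_letter g (h \<otimes>\<^bsub>G\<^esub> h')],
       [tensor_letter g h, tensor_letter (conj_act G h g) (conj_act G h h')]) | g h h'.
        g \<in> carrier G \<and> h \<in> carrier G \<and> h' \<in> carrier G}"

definition tensor_square :: "('a, 'b) monoid_scheme \<Rightarrow> ('a \<times> 'a) word set monoid" where
  "tensor_square G = presented_group (carrier G \<times> carrier G) (tensor_square_rels G)"

abbreviation Z :: "nat \<Rightarrow> int monoid" where
  "Z n \<equiv> integer_mod_group n"

definition copies :: "nat \<Rightarrow> ('a, 'b) monoid_scheme \<Rightarrow> (nat \<Rightarrow> 'a) monoid" where
  "copies n A = sum_group {..<n} (\<lambda>_. A)"

end

theory Submission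
  imports Defs "HOL-Algebra.FiniteProduct" "HOL-Combinatorics.List_Permutation"
begin

text \<open>
  For abelian \<open>G\<close> the conjugation actions are trivial, so \<open>g \<otimes> h\<close> is bimultiplicative and \<open>G \<otimes> G\<close>
  is abelian. If \<open>G\<close> is a direct sum of cyclic groups of orders \<open>n\<^sub>i\<close> with generators \<open>e\<^sub>i\<close>, then the
  \<open>e\<^sub>i \<otimes> e\<^sub>j\<close> generate \<open>G \<otimes> G\<close> and have order dividing \<open>gcd n\<^sub>i n\<^sub>j\<close>; multiplying coordinates modulo
  \<open>gcd n\<^sub>i n\<^sub>j\<close> shows that there are no further relations. So \<open>G \<otimes> G\<close> is the direct sum of the
  cyclic groups of order \<open>gcd n\<^sub>i n\<^sub>j\<close>, and it remains to count the gcds.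
\<close>

section \<open>Homomorphisms, finite products and powers\<close>

lemma hom_finprod:
  assumes "comm_group G" "comm_group H" "h \<in> hom G H" "f \<in> A \<rightarrow> carrier G"
  shows "h (finprod G f A) = finprod H (\<lambda>x. h (f x)) A"
proof -
  interpret G: comm_group G by fact
  interpret H: comm_group H by fact
  interpret h: group_hom G H h
    using assms(3) by (simp add: group_hom_def group_hom_axioms_def G.is_group H.is_group)
  show ?thesis
    using assms(4) by (induction A rule: infinite_finite_induct) (auto simp: Pi_iff)
qed

lemma (in comm_group) subgroup_finprod_closed:
  assumes "subgroup K G" "f \<in> A \<rightarrow> K"
  shows "finprod G f A \<in> K"
  using assms(2)
proof (induction A rule: infinite_finite_induct)
  case (insert x A)
  then have "f \<in> A \<rightarrow> carrier G" "f x \<in> carrier G"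
    using subgroup.subset[OF assms(1)] by auto
  then show ?case
    using insert subgroup.m_closed[OF assms(1)] by auto
qed (simp_all add: subgroup.one_closed[OF assms(1)])

text \<open>Homomorphisms that agree on generators are equal: their equalizer is a subgroup, so it
  is everything once it contains a generating set. This is how identities of maps are reduced to
  generators below.\<close>

lemma (in group) subgroup_agree:
  assumes "f \<in> hom G H" "g \<in> hom G H" "group H"
  shows "subgroup {x \<in> carrier G. f x = g x} G"
proof -
  interpret f: group_hom G H f
    using assms by (simp add: group_hom_def group_hom_axioms_def is_group)
  interpret g: group_hom G H g
    using assms by (simp add: group_hom_def group_hom_axioms_def is_group)
  show ?thesis
    by unfold_locales auto
qed

text \<open>Addition in \<open>Z m\<close> ends with a reduction modulo \<open>m\<close>; this lets
  that reduction be dropped in an exponent. It covers \<open>m = 0\<close> too, since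
  \<open>k mod 0 = k\<close>.\<close>

lemma (in group) int_pow_mod:
  assumes "x \<in> carrier G" "x [^] (m::int) = \<one>"
  shows "x [^] (k mod m) = x [^] k"
proof -
  have "x [^] k = x [^] (m * (k div m) + k mod m)"
    by simp
  also have "\<dots> = (x [^] m) [^] (k div m) \<otimes> x [^] (k mod m)"
    unfolding int_pow_mult[OF assms(1)] int_pow_pow[OF assms(1)] ..
  finally show ?thesis
    using assms by simp
qed

text \<open>By Bezout the gcd is an integer combination of \<open>m\<close> and \<open>n\<close>,
  and both powers vanish.\<close>

lemma (in group) int_pow_gcd:
  assumes "x \<in> carrier G" "x [^] (m::int) = \<one>" "x [^] (n::int) = \<one>"
  shows "x [^] gcd m n = \<one>"
proof -
  obtain u v where "u * m + v * n = gcd m n"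
    using bezout_int by blast
  then have "x [^] gcd m n = x [^] (m * u + n * v)"
    by (simp add: mult.commute)
  also have "\<dots> = (x [^] m) [^] u \<otimes> (x [^] n) [^] v"
    unfolding int_pow_mult[OF assms(1)] int_pow_pow[OF assms(1)] ..
  finally show ?thesis
    using assms by simp
qed

section \<open>Finite direct sums of cyclic groups\<close>

definition cyclic_sum :: "'i set \<Rightarrow> ('i \<Rightarrow> nat) \<Rightarrow> ('i \<Rightarrow> int) monoid" where
  "cyclic_sum I n = sum_group I (\<lambda>i. Z (n i))"

text \<open>The standard generator of summand \<open>i\<close>. The entry is
  \<open>1 mod int (n i)\<close> because residues are kept reduced: for \<open>n i = 1\<close> it
  has to be \<open>0\<close>. For \<open>i\<close> outside \<open>I\<close> the result is the
  neutral element, so it always lies in the carrier.\<close>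

definition cyclic_unit :: "'i set \<Rightarrow> ('i \<Rightarrow> nat) \<Rightarrow> 'i \<Rightarrow> 'i \<Rightarrow> int" where
  "cyclic_unit I n i = (\<lambda>j\<in>I. if j = i then 1 mod int (n i) else 0)"

lemma mod_carrier_integer_mod_group: "x mod int n \<in> carrier (Z n)"
  by (simp add: carrier_integer_mod_group)

lemma mod_integer_mod_group: "x \<in> carrier (Z n) \<Longrightarrow> x mod int n = x"
  by (auto simp: carrier_integer_mod_group split: if_splits)

lemma carrier_cyclic_sum:
  "finite I \<Longrightarrow> carrier (cyclic_sum I n) = (\<Pi>\<^sub>E i\<in>I. carrier (Z (n i)))"
  by (auto simp: cyclic_sum_def carrier_sum_group)

lemma mult_cyclic_sum:
  "c \<otimes>\<^bsub>cyclic_sum I n\<^esub> d = (\<lambda>i\<in>I. (c i + d i) mod int (n i))"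
  by (simp add: cyclic_sum_def)

lemma one_cyclic_sum: "\<one>\<^bsub>cyclic_sum I n\<^esub> = (\<lambda>i\<in>I. 0)"
  by (simp add: cyclic_sum_def)

lemma comm_group_cyclic_sum:
  assumes "finite I"
  shows "comm_group (cyclic_sum I n)"
proof -
  interpret group "cyclic_sum I n"
    by (simp add: cyclic_sum_def)
  show ?thesis
    by unfold_locales (simp add: mult_cyclic_sum add.commute)
qed

lemma cyclic_unit_carrier: "finite I \<Longrightarrow> cyclic_unit I n i \<in> carrier (cyclic_sum I n)"
  by (auto simp: carrier_cyclic_sum cyclic_unit_def mod_carrier_integer_mod_group)

lemma proj_cyclic_sum_hom:
  "finite I \<Longrightarrow> i \<in> I \<Longrightarrow> (\<lambda>c. c i) \<in> hom (cyclic_sum I n) (Z (n i))"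
  by (rule homI) (auto simp: carrier_cyclic_sum mult_cyclic_sum)

text \<open>It suffices to compare coordinates. Each projection is a homomorphism, so it passes
  through the product, and in coordinate \<open>j\<close> only the factor \<open>i = j\<close>
  contributes.\<close>

lemma cyclic_sum_expansion:
  assumes I: "finite I" and c: "c \<in> carrier (cyclic_sum I n)"
  shows "finprod (cyclic_sum I n) (\<lambda>i. cyclic_unit I n i [^]\<^bsub>cyclic_sum I n\<^esub> c i) I = c"
    (is "?s = c")
proof -
  interpret C: comm_group "cyclic_sum I n"
    by (rule comm_group_cyclic_sum[OF I])
  have u: "(\<lambda>i. cyclic_unit I n i [^]\<^bsub>cyclic_sum I n\<^esub> c i) \<in> I \<rightarrow> carrier (cyclic_sum I n)"
    using cyclic_unit_carrier[OF I] by auto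
  have "?s \<in> carrier (cyclic_sum I n)"
    using u by (rule C.finprod_closed)
  moreover have "?s j = c j" if j: "j \<in> I" for j
  proof -
    interpret Zj: comm_group "Z (n j)" by simp
    note proj = proj_cyclic_sum_hom[OF I j, of n]
    have cj: "c j \<in> carrier (Z (n j))"
      using c j I by (auto simp: carrier_cyclic_sum)
    have "?s j = finprod (Z (n j)) (\<lambda>i. (cyclic_unit I n i [^]\<^bsub>cyclic_sum I n\<^esub> c i) j) I"
      by (rule hom_finprod[OF C.comm_group_axioms _ proj u]) simp
    also have "\<dots> = finprod (Z (n j)) (\<lambda>i. if i = j then c i else \<one>\<^bsub>Z (n j)\<^esub>) I"
    proof (rule Zj.finprod_cong')
      fix i assume "i \<in> I"
      have "(cyclic_unit I n i [^]\<^bsub>cyclic_sum I n\<^esub> c i) j = cyclic_unit I n i j [^]\<^bsub>Z (n j)\<^esub> c i"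
        by (rule hom_int_pow[OF proj cyclic_unit_carrier[OF I] C.is_group]) simp
      also have "\<dots> = (if i = j then c i else \<one>\<^bsub>Z (n j)\<^esub>)"
        using j cj mod_integer_mod_group[of "c j" "n j"]
        by (simp add: int_pow_integer_mod_group cyclic_unit_def mod_mult_right_eq)
      finally show "(cyclic_unit I n i [^]\<^bsub>cyclic_sum I n\<^esub> c i) j = (if i = j then c i else \<one>\<^bsub>Z (n j)\<^esub>)" .
    qed (use cj in auto)
    \<comment> \<open>For \<open>i \<noteq> j\<close> the value \<open>c i\<close> need not lie in
      \<open>Z (n j)\<close>. The constant \<open>c j\<close> does, as the evaluation of the product
      requires.\<close>
    also have "\<dots> = finprod (Z (n j)) (\<lambda>i. if i = j then c j else \<one>\<^bsub>Z (n j)\<^esub>) I"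
      by (rule arg_cong[where f = "\<lambda>f. finprod _ f _"]) auto
    also have "\<dots> = c j"
      using cj by (intro Zj.finprod_singleton_swap[OF j I, of "\<lambda>_. c j"]) simp
    finally show ?thesis .
  qed
  ultimately show ?thesis
    using c I by (auto simp: carrier_cyclic_sum intro: PiE_ext)
qed

lemma cyclic_unit_pow:
  assumes I: "finite I" and i: "i \<in> I"
  shows "cyclic_unit I n i [^]\<^bsub>cyclic_sum I n\<^esub> int (n i) = \<one>\<^bsub>cyclic_sum I n\<^esub>" (is "?p = _")
proof -
  interpret C: comm_group "cyclic_sum I n"
    by (rule comm_group_cyclic_sum[OF I])
  have "?p \<in> carrier (cyclic_sum I n)"
    by (simp add: cyclic_unit_carrier[OF I])
  moreover have "?p j = 0" if j: "j \<in> I" for j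
    using hom_int_pow[OF proj_cyclic_sum_hom[OF I j] cyclic_unit_carrier[OF I] C.is_group] j
    by (auto simp: int_pow_integer_mod_group cyclic_unit_def)
  ultimately show ?thesis
    using C.one_closed by (auto simp: carrier_cyclic_sum I one_cyclic_sum intro!: PiE_ext)
qed

lemma subgroup_cyclic_sum_eq:
  assumes I: "finite I" and K: "subgroup K (cyclic_sum I n)" "cyclic_unit I n ` I \<subseteq> K"
  shows "K = carrier (cyclic_sum I n)"
proof
  interpret C: comm_group "cyclic_sum I n"
    by (rule comm_group_cyclic_sum[OF I])
  show "K \<subseteq> carrier (cyclic_sum I n)"
    by (rule subgroup.subset[OF K(1)])
  show "carrier (cyclic_sum I n) \<subseteq> K"
  proof
    fix c assume "c \<in> carrier (cyclic_sum I n)"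
    then have "c = finprod (cyclic_sum I n) (\<lambda>i. cyclic_unit I n i [^]\<^bsub>cyclic_sum I n\<^esub> c i) I"
      by (rule cyclic_sum_expansion[OF I, symmetric])
    also have "\<dots> \<in> K"
      using K(2) by (intro C.subgroup_finprod_closed[OF K(1)]) (auto intro: C.subgroup_int_pow_closed[OF K(1)])
    finally show "c \<in> K" .
  qed
qed

text \<open>The inverse of \<open>\<phi>\<close> sends \<open>c\<close> to the product of the powers
  of \<open>t i\<close> with exponents \<open>c i\<close>. The bounds \<open>t_pow\<close> make this
  a homomorphism in spite of the reductions modulo \<open>n i\<close>. Generation bounds
  \<open>T\<close> from above, while \<open>\<phi>\<close> shows that no further relations
  hold.\<close>

lemma iso_cyclic_sumI:
  assumes T: "comm_group T" and I: "finite I" and t: "t \<in> I \<rightarrow> carrier T"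
    and gen: "\<And>K. subgroup K T \<Longrightarrow> t ` I \<subseteq> K \<Longrightarrow> carrier T \<subseteq> K"
    and hom: "\<phi> \<in> hom T (cyclic_sum I n)"
    and \<phi>_t: "\<And>i. i \<in> I \<Longrightarrow> \<phi> (t i) = cyclic_unit I n i"
    and t_pow: "\<And>i. i \<in> I \<Longrightarrow> t i [^]\<^bsub>T\<^esub> int (n i) = \<one>\<^bsub>T\<^esub>"
  shows "\<phi> \<in> iso T (cyclic_sum I n)"
proof -
  interpret T: comm_group T by fact
  interpret C: comm_group "cyclic_sum I n"
    by (rule comm_group_cyclic_sum[OF I])
  define \<psi> where "\<psi> c = finprod T (\<lambda>i. t i [^]\<^bsub>T\<^esub> (c i::int)) I" for c
  have t_closed: "t i \<in> carrier T" if "i \<in> I" for i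
    using t that by auto
  have pow_closed: "(\<lambda>i. t i [^]\<^bsub>T\<^esub> (c i::int)) \<in> I \<rightarrow> carrier T" for c
    using t_closed by auto
  have \<psi>_hom: "\<psi> \<in> hom (cyclic_sum I n) T"
  proof (rule homI)
    fix c d
    have "\<psi> (c \<otimes>\<^bsub>cyclic_sum I n\<^esub> d) = finprod T (\<lambda>i. t i [^]\<^bsub>T\<^esub> c i \<otimes>\<^bsub>T\<^esub> t i [^]\<^bsub>T\<^esub> d i) I"
      unfolding \<psi>_def
      by (rule T.finprod_cong')
        (use t_closed in \<open>auto simp: mult_cyclic_sum T.int_pow_mod t_pow T.int_pow_mult\<close>)
    then show "\<psi> (c \<otimes>\<^bsub>cyclic_sum I n\<^esub> d) = \<psi> c \<otimes>\<^bsub>T\<^esub> \<psi> d"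
      unfolding \<psi>_def by (simp add: T.finprod_multf[OF pow_closed pow_closed])
  qed (use pow_closed in \<open>auto simp: \<psi>_def\<close>)
  have \<phi>_closed: "\<phi> a \<in> carrier (cyclic_sum I n)" if "a \<in> carrier T" for a
    using hom that by (rule hom_in_carrier)
  have \<psi>_closed: "\<psi> c \<in> carrier T" if "c \<in> carrier (cyclic_sum I n)" for c
    using \<psi>_hom that by (rule hom_in_carrier)
  have \<psi>_unit: "\<psi> (cyclic_unit I n i) = t i" if i: "i \<in> I" for i
  proof -
    have "\<psi> (cyclic_unit I n i) = finprod T (\<lambda>j. if j = i then t j else \<one>\<^bsub>T\<^esub>) I"
      unfolding \<psi>_def
      by (rule T.finprod_cong')
        (use t_closed in \<open>auto simp: cyclic_unit_def T.int_pow_mod t_pow\<close>)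
    also have "\<dots> = t i"
      by (rule T.finprod_singleton_swap[OF i I t])
    finally show ?thesis .
  qed
  \<comment> \<open>Both \<open>\<psi> \<circ> \<phi>\<close> and the identity fix every
    \<open>t i\<close>, so by \<open>gen\<close> they agree on all of \<open>T\<close>.\<close>
  have "subgroup {a \<in> carrier T. (\<psi> \<circ> \<phi>) a = id a} T"
    using hom_compose[OF hom \<psi>_hom]
    by (rule T.subgroup_agree) (simp_all add: hom_def Pi_iff T.is_group)
  then have "carrier T \<subseteq> {a \<in> carrier T. (\<psi> \<circ> \<phi>) a = id a}"
    by (rule gen) (use t_closed \<phi>_t \<psi>_unit in auto)
  then have \<psi>\<phi>: "\<psi> (\<phi> a) = a" if "a \<in> carrier T" for a
    using that by auto
  \<comment> \<open>Applying \<open>\<phi>\<close> to the product that defines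
    \<open>\<psi> c\<close> turns each \<open>t i\<close> into a standard generator and yields the
    expansion of \<open>c\<close>.\<close>
  have \<phi>\<psi>: "\<phi> (\<psi> c) = c" if c: "c \<in> carrier (cyclic_sum I n)" for c
  proof -
    have "\<phi> (\<psi> c) = finprod (cyclic_sum I n) (\<lambda>i. \<phi> (t i [^]\<^bsub>T\<^esub> c i)) I"
      unfolding \<psi>_def
      by (rule hom_finprod[OF T C.comm_group_axioms hom pow_closed])
    also have "\<dots> = finprod (cyclic_sum I n) (\<lambda>i. cyclic_unit I n i [^]\<^bsub>cyclic_sum I n\<^esub> c i) I"
      by (rule C.finprod_cong')
        (use cyclic_unit_carrier[OF I] t_closed in
          \<open>auto simp: hom_int_pow[OF hom _ T.is_group C.is_group] \<phi>_t\<close>)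
    finally show ?thesis
      by (simp add: cyclic_sum_expansion[OF I c])
  qed
  have "bij_betw \<phi> (carrier T) (carrier (cyclic_sum I n))"
    by (rule bij_betw_byWitness[where f' = \<psi>]) (use \<phi>\<psi> \<psi>\<phi> \<phi>_closed \<psi>_closed in auto)
  with hom show ?thesis
    by (rule isoI)
qed

text \<open>The isomorphism is pullback along \<open>f\<close>, with pullback along the inverse
  bijection \<open>g\<close> as its inverse. Restricting to the index set keeps the functions
  extensional, so the two are exactly inverse.\<close>

lemma cyclic_sum_reindex:
  assumes f: "bij_betw f I J" and "finite I" and n: "\<And>i. i \<in> I \<Longrightarrow> n i = m (f i)"
  shows "cyclic_sum J m \<cong> cyclic_sum I n"
proof (rule is_isoI)
  have J: "finite J"
    using f \<open>finite I\<close> bij_betw_finite by blast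
  have fI: "f i \<in> J" if "i \<in> I" for i
    using f that by (rule bij_betw_apply)
  define g where "g = the_inv_into I f"
  have g: "g j \<in> I" "f (g j) = j" if "j \<in> J" for j
    using bij_betw_the_inv_into[OF f] f_the_inv_into_f_bij_betw[OF f] that
    by (auto simp: g_def bij_betw_apply)
  have gf: "g (f i) = i" if "i \<in> I" for i
    using f that by (simp add: g_def the_inv_into_f_f bij_betw_def)
  show "(\<lambda>c. \<lambda>i\<in>I. c (f i)) \<in> iso (cyclic_sum J m) (cyclic_sum I n)"
  proof (rule isoI)
    show "(\<lambda>c. \<lambda>i\<in>I. c (f i)) \<in> hom (cyclic_sum J m) (cyclic_sum I n)"
      using n fI by (intro homI)
        (auto simp: carrier_cyclic_sum \<open>finite I\<close> J mult_cyclic_sum fun_eq_iff)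
    show "bij_betw (\<lambda>c. \<lambda>i\<in>I. c (f i)) (carrier (cyclic_sum J m)) (carrier (cyclic_sum I n))"
      by (rule bij_betw_byWitness[where f' = "\<lambda>c. \<lambda>j\<in>J. c (g j)"])
        (use n fI g gf in \<open>fastforce simp: carrier_cyclic_sum \<open>finite I\<close> J fun_eq_iff PiE_iff extensional_def\<close>)+
  qed
qed

section \<open>Cyclic sums given by lists of orders\<close>

definition cyclic_list :: "nat list \<Rightarrow> (nat \<Rightarrow> int) monoid" where
  "cyclic_list ns = cyclic_sum {..<length ns} (\<lambda>i. ns ! i)"

text \<open>Equal multisets mean that the lists differ by a bijection of positions, along which the
  sum is reindexed. Comparing direct sums thus becomes an identity of multisets of orders.\<close>

lemma cyclic_list_mset_cong:
  assumes "mset ms = mset ns"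
  shows "cyclic_list ns \<cong> cyclic_list ms"
proof -
  obtain f where "bij_betw f {..<length ms} {..<length ns}" "\<forall>i<length ms. ms ! i = ns ! f i"
    using permutation_Ex_bij[OF assms] by blast
  then show ?thesis
    unfolding cyclic_list_def by (intro cyclic_sum_reindex) auto
qed

lemma Z_iso_cyclic_list: "Z n \<cong> cyclic_list [n]"
proof (rule is_isoI)
  show "(\<lambda>x. \<lambda>i\<in>{..<1}. x) \<in> iso (Z n) (cyclic_list [n])"
  proof (rule isoI)
    show "(\<lambda>x. \<lambda>i\<in>{..<1}. x) \<in> hom (Z n) (cyclic_list [n])"
      by (rule homI) (auto simp: cyclic_list_def carrier_cyclic_sum mult_cyclic_sum fun_eq_iff)
    show "bij_betw (\<lambda>x. \<lambda>i\<in>{..<1}. x) (carrier (Z n)) (carrier (cyclic_list [n]))"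
    proof (rule bij_betw_byWitness[where f' = "\<lambda>c. c 0"])
      show "\<forall>c\<in>carrier (cyclic_list [n]). (\<lambda>i\<in>{..<1}. c 0) = c"
      proof
        fix c assume "c \<in> carrier (cyclic_list [n])"
        then have "c \<in> extensional {..<1}"
          by (simp add: cyclic_list_def carrier_cyclic_sum PiE_iff)
        then show "(\<lambda>i\<in>{..<1}. c 0) = c"
          by (rule extensionalityI[OF restrict_extensional]) simp
      qed
    qed (simp_all add: cyclic_list_def carrier_cyclic_sum PiE_iff image_subset_iff)
  qed
qed

lemma copies_iso_cyclic_list: "copies k (Z n) \<cong> cyclic_list (replicate k n)"
proof -
  have "cyclic_sum {..<k} (\<lambda>_. n) \<cong> cyclic_list (replicate k n)"
    unfolding cyclic_list_def by (rule cyclic_sum_reindex[where f = id]) auto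
  then show ?thesis
    by (simp add: copies_def cyclic_sum_def)
qed

text \<open>\<open>?h\<close> glues two families, shifting the second by \<open>length xs\<close>;
  \<open>?k\<close> cuts the glued family at that position.\<close>

lemma cyclic_list_append: "cyclic_list xs \<times>\<times> cyclic_list ys \<cong> cyclic_list (xs @ ys)"
proof (rule is_isoI)
  let ?h = "\<lambda>(c, d). \<lambda>i\<in>{..<length (xs @ ys)}. if i < length xs then c i else d (i - length xs)"
  let ?k = "\<lambda>c. (\<lambda>i\<in>{..<length xs}. c i, \<lambda>i\<in>{..<length ys}. c (length xs + i))"
  show "?h \<in> iso (cyclic_list xs \<times>\<times> cyclic_list ys) (cyclic_list (xs @ ys))"
  proof (rule isoI)
    show "?h \<in> hom (cyclic_list xs \<times>\<times> cyclic_list ys) (cyclic_list (xs @ ys))"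
      by (rule homI)
        (fastforce simp: cyclic_list_def carrier_cyclic_sum mult_cyclic_sum fun_eq_iff nth_append PiE_iff)+
    show "bij_betw ?h (carrier (cyclic_list xs \<times>\<times> cyclic_list ys)) (carrier (cyclic_list (xs @ ys)))"
    proof (rule bij_betw_byWitness[where f' = ?k])
      show "\<forall>a\<in>carrier (cyclic_list xs \<times>\<times> cyclic_list ys). ?k (?h a) = a"
        by (auto simp: cyclic_list_def carrier_cyclic_sum fun_eq_iff PiE_iff extensional_def)
      show "\<forall>c\<in>carrier (cyclic_list (xs @ ys)). ?h (?k c) = c"
        by (auto simp: cyclic_list_def carrier_cyclic_sum fun_eq_iff PiE_iff extensional_def)
      show "?h ` carrier (cyclic_list xs \<times>\<times> cyclic_list ys) \<subseteq> carrier (cyclic_list (xs @ ys))"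
        by (auto simp: cyclic_list_def carrier_cyclic_sum nth_append PiE_iff)
      show "?k ` carrier (cyclic_list (xs @ ys)) \<subseteq> carrier (cyclic_list xs \<times>\<times> cyclic_list ys)"
      proof (rule image_subsetI)
        fix c assume "c \<in> carrier (cyclic_list (xs @ ys))"
        then have c: "c i \<in> carrier (Z ((xs @ ys) ! i))" if "i < length xs + length ys" for i
          using that by (auto simp: cyclic_list_def carrier_cyclic_sum)
        have "c i \<in> carrier (Z (xs ! i))" if "i < length xs" for i
          using that c[of i] by (simp add: nth_append)
        moreover have "c (length xs + i) \<in> carrier (Z (ys ! i))" if "i < length ys" for i
          using that c[of "length xs + i"] by simp
        ultimately show "?k c \<in> carrier (cyclic_list xs \<times>\<times> cyclic_list ys)"
          by (simp add: cyclic_list_def carrier_cyclic_sum)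
      qed
    qed
  qed
qed

lemma DirProd_iso_cyclic_list:
  assumes "group A" "A \<cong> cyclic_list xs" "B \<cong> cyclic_list ys"
  shows "A \<times>\<times> B \<cong> cyclic_list (xs @ ys)"
  using group.DirProd_iso_trans[OF assms] cyclic_list_append by (rule iso_trans)

section \<open>The tensor square of an abelian group\<close>

lemma presented_group_subgroup_eq:
  assumes K: "subgroup K (presented_group S R)"
    and gens: "\<And>x. x \<in> S \<Longrightarrow> word_cong S R `` {[(x, True)]} \<in> K"
  shows "K = carrier (presented_group S R)"
proof
  let ?P = "presented_group S R"
  interpret P: group ?P
    by (rule group_presented_group)
  show "K \<subseteq> carrier ?P"
    by (rule subgroup.subset[OF K])
  \<comment> \<open>A formal inverse letter represents the inverse of its generator, so it also lies
    in \<open>K\<close>; words then follow letter by letter.\<close>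
  have letter: "word_cong S R `` {[(x, b)]} \<in> K" if x: "x \<in> S" for x b
  proof (cases b)
    case False
    have "word_cong S R `` {[(x, False)]} \<otimes>\<^bsub>?P\<^esub> word_cong S R `` {[(x, True)]} = word_cong S R `` {[]}"
      using x word_cong.cancel[OF x, of False R]
      by (simp add: mult_presented_group equiv_class_eq[OF equiv_word_cong])
    then have "word_cong S R `` {[(x, False)]} = inv\<^bsub>?P\<^esub> (word_cong S R `` {[(x, True)]})"
      using x by (intro P.inv_equality[symmetric])
        (simp_all add: carrier_presented_groupI, simp add: presented_group_def)
    then show ?thesis
      using False subgroup.m_inv_closed[OF K gens[OF x]] by simp
  qed (use gens x in simp)
  have "word_cong S R `` {u} \<in> K" if "u \<in> words S" for u
    using that
  proof (induction u)
    case Nil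
    then show ?case
      using subgroup.one_closed[OF K] by (simp add: presented_group_def)
  next
    case (Cons a u)
    then have a: "fst a \<in> S" and u: "u \<in> words S"
      by auto
    have "word_cong S R `` {a # u} = word_cong S R `` {[a]} \<otimes>\<^bsub>?P\<^esub> word_cong S R `` {u}"
      using mult_presented_group[of "[a]" S u R] a u by simp
    then show ?case
      using subgroup.m_closed[OF K letter[OF a, of "snd a"] Cons.IH[OF u]] by simp
  qed
  then show "carrier ?P \<subseteq> K"
    by (auto elim!: carrier_presented_groupE)
qed

text \<open>Centralizers, here \<open>C B\<close>, are subgroups. Hence commutation extends from
  generators to all elements, one argument at a time.\<close>

lemma comm_group_presented_group:
  assumes comm: "\<And>x y. x \<in> S \<Longrightarrow> y \<in> S \<Longrightarrow>
    word_cong S R `` {[(x, True)]} \<otimes>\<^bsub>presented_group S R\<^esub> word_cong S R `` {[(y, True)]} =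
    word_cong S R `` {[(y, True)]} \<otimes>\<^bsub>presented_group S R\<^esub> word_cong S R `` {[(x, True)]}"
  shows "comm_group (presented_group S R)"
proof -
  let ?P = "presented_group S R"
  interpret P: group ?P
    by (rule group_presented_group)
  define C where "C B = {a \<in> carrier ?P. \<forall>b\<in>B. a \<otimes>\<^bsub>?P\<^esub> b = b \<otimes>\<^bsub>?P\<^esub> a}" for B
  have C: "subgroup (C B) ?P" if B: "B \<subseteq> carrier ?P" for B
  proof (rule P.subgroupI)
    show "C B \<noteq> {}"
      using B by (auto simp: C_def intro!: exI[of _ "\<one>\<^bsub>?P\<^esub>"])
    show "inv\<^bsub>?P\<^esub> a \<in> C B" if "a \<in> C B" for a
    proof -
      have "inv\<^bsub>?P\<^esub> a \<otimes>\<^bsub>?P\<^esub> b = b \<otimes>\<^bsub>?P\<^esub> inv\<^bsub>?P\<^esub> a" if "b \<in> B" for b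
      proof -
        have ab: "a \<in> carrier ?P" "b \<in> carrier ?P" "a \<otimes>\<^bsub>?P\<^esub> b = b \<otimes>\<^bsub>?P\<^esub> a"
          using that \<open>a \<in> C B\<close> B by (auto simp: C_def)
        then have "b = a \<otimes>\<^bsub>?P\<^esub> b \<otimes>\<^bsub>?P\<^esub> inv\<^bsub>?P\<^esub> a"
          by (simp add: P.inv_solve_right)
        then have "b = a \<otimes>\<^bsub>?P\<^esub> (b \<otimes>\<^bsub>?P\<^esub> inv\<^bsub>?P\<^esub> a)"
          using ab(1,2) by (simp add: P.m_assoc)
        then have "b \<otimes>\<^bsub>?P\<^esub> inv\<^bsub>?P\<^esub> a = inv\<^bsub>?P\<^esub> a \<otimes>\<^bsub>?P\<^esub> b"
          using ab(1,2) by (subst P.inv_solve_left) auto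
        then show ?thesis ..
      qed
      then show ?thesis
        using that by (simp add: C_def)
    qed
    show "a \<otimes>\<^bsub>?P\<^esub> a' \<in> C B" if "a \<in> C B" "a' \<in> C B" for a a'
    proof -
      have "a \<otimes>\<^bsub>?P\<^esub> a' \<otimes>\<^bsub>?P\<^esub> b = b \<otimes>\<^bsub>?P\<^esub> (a \<otimes>\<^bsub>?P\<^esub> a')" if "b \<in> B" for b
      proof -
        have "a \<in> carrier ?P" "a' \<in> carrier ?P" "b \<in> carrier ?P"
          "a \<otimes>\<^bsub>?P\<^esub> b = b \<otimes>\<^bsub>?P\<^esub> a" "a' \<otimes>\<^bsub>?P\<^esub> b = b \<otimes>\<^bsub>?P\<^esub> a'"
          using that \<open>a \<in> C B\<close> \<open>a' \<in> C B\<close> B by (auto simp: C_def)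
        then show ?thesis
          by (metis P.m_assoc)
      qed
      then show ?thesis
        using that by (simp add: C_def)
    qed
  qed (auto simp: C_def)
  let ?gens = "(\<lambda>x. word_cong S R `` {[(x, True)]}) ` S"
  have gens: "?gens \<subseteq> carrier ?P"
    by (auto intro: carrier_presented_groupI)
  \<comment> \<open>First argument: the centralizer of the generators contains the generators, so it
    is the whole group.\<close>
  then have "C ?gens = carrier ?P"
    using comm by (intro presented_group_subgroup_eq[OF C]) (auto simp: C_def)
  \<comment> \<open>Second argument: read the other way round, the generators are central, so the
    center is the whole group.\<close>
  then have "?gens \<subseteq> C (carrier ?P)"
    using gens by (fastforce simp: C_def)
  then have "C (carrier ?P) = carrier ?P"
    by (intro presented_group_subgroup_eq[OF C]) auto
  then show ?thesis
    by (intro P.group_comm_groupI) (auto simp: C_def)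
qed

section \<open>Pure tensors and the universal property\<close>

definition tensor :: "('a, 'b) monoid_scheme \<Rightarrow> 'a \<Rightarrow> 'a \<Rightarrow> ('a \<times> 'a) word set" where
  "tensor G g h = word_cong (carrier G \<times> carrier G) (tensor_square_rels G) `` {[tensor_letter g h]}"

lemma group_tensor_square: "group (tensor_square G)"
  by (simp add: tensor_square_def group_presented_group)

lemma tensor_closed:
  "g \<in> carrier G \<Longrightarrow> h \<in> carrier G \<Longrightarrow> tensor G g h \<in> carrier (tensor_square G)"
  by (simp add: tensor_def tensor_square_def carrier_presented_groupI)

lemma (in comm_group) conj_act_eq: "g \<in> carrier G \<Longrightarrow> h \<in> carrier G \<Longrightarrow> conj_act G g h = h"
  by (simp add: conj_act_def m_comm[of g h] m_assoc)

text \<open>This is the first defining relation with trivial conjugation. The factors keep its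
  reversed order, because commutativity of the tensor square is derived only afterwards, from this
  and the mirror rule.\<close>

lemma (in comm_group) tensor_mult_left:
  assumes "g \<in> carrier G" "g' \<in> carrier G" "h \<in> carrier G"
  shows "tensor G (g \<otimes> g') h = tensor G g' h \<otimes>\<^bsub>tensor_square G\<^esub> tensor G g h"
proof -
  have "([tensor_letter (g \<otimes> g') h], [tensor_letter (conj_act G g g') (conj_act G g h), tensor_letter g h])
      \<in> word_cong (carrier G \<times> carrier G) (tensor_square_rels G)"
  proof (rule word_cong.rel)
    show "([tensor_letter (g \<otimes> g') h], [tensor_letter (conj_act G g g') (conj_act G g h), tensor_letter g h]) \<in> tensor_square_rels G"
      unfolding tensor_square_rels_def using assms by blast
  qed (use assms in \<open>simp_all add: conj_act_eq\<close>)
  then show ?thesis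
    using assms equiv_class_eq[OF equiv_word_cong]
    by (simp add: tensor_def tensor_square_def mult_presented_group conj_act_eq)
qed

lemma (in comm_group) tensor_mult_right:
  assumes "g \<in> carrier G" "h \<in> carrier G" "h' \<in> carrier G"
  shows "tensor G g (h \<otimes> h') = tensor G g h \<otimes>\<^bsub>tensor_square G\<^esub> tensor G g h'"
proof -
  have "([tensor_letter g (h \<otimes> h')], [tensor_letter g h, tensor_letter (conj_act G h g) (conj_act G h h')])
      \<in> word_cong (carrier G \<times> carrier G) (tensor_square_rels G)"
  proof (rule word_cong.rel)
    show "([tensor_letter g (h \<otimes> h')], [tensor_letter g h, tensor_letter (conj_act G h g) (conj_act G h h')]) \<in> tensor_square_rels G"
      unfolding tensor_square_rels_def using assms by blast
  qed (use assms in \<open>simp_all add: conj_act_eq\<close>)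
  then show ?thesis
    using assms equiv_class_eq[OF equiv_word_cong]
    by (simp add: tensor_def tensor_square_def mult_presented_group conj_act_eq)
qed

text \<open>Expanding \<open>gg' \<otimes> hh'\<close> first in the left or first in the right argument and cancelling the
  outer factors shows that the generators commute.\<close>

lemma (in comm_group) comm_group_tensor_square: "comm_group (tensor_square G)"
proof -
  interpret T: group "tensor_square G"
    by (rule group_tensor_square)
  have "tensor G g h \<otimes>\<^bsub>tensor_square G\<^esub> tensor G g' h' = tensor G g' h' \<otimes>\<^bsub>tensor_square G\<^esub> tensor G g h"
    if G: "g \<in> carrier G" "h \<in> carrier G" "g' \<in> carrier G" "h' \<in> carrier G" for g h g' h'
  proof -
    note [simp] = tensor_closed G
    let ?m = "\<lambda>a b. a \<otimes>\<^bsub>tensor_square G\<^esub> b"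
    have "?m (tensor G g' h) (?m (?m (tensor G g h) (tensor G g' h')) (tensor G g h')) =
        tensor G (g \<otimes> g') (h \<otimes> h')"
      by (simp add: tensor_mult_right tensor_mult_left T.m_assoc)
    also have "\<dots> = ?m (tensor G g' h) (?m (?m (tensor G g' h') (tensor G g h)) (tensor G g h'))"
      by (subst tensor_mult_left) (simp_all add: tensor_mult_right T.m_assoc)
    finally show ?thesis
      by simp
  qed
  then show ?thesis
    unfolding tensor_square_def tensor_def
    by (intro comm_group_presented_group) auto
qed

lemma (in comm_group) tensor_left_hom:
  assumes "h \<in> carrier G"
  shows "(\<lambda>g. tensor G g h) \<in> hom G (tensor_square G)"
proof -
  interpret T: comm_group "tensor_square G"
    by (rule comm_group_tensor_square)
  show ?thesis
    using assms by (intro homI) (simp_all add: tensor_closed tensor_mult_left T.m_comm)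
qed

lemma (in comm_group) tensor_right_hom:
  "g \<in> carrier G \<Longrightarrow> tensor G g \<in> hom G (tensor_square G)"
  by (rule homI) (simp_all add: tensor_closed tensor_mult_right)

text \<open>The universal property for maps multiplicative in each argument: with trivial
  conjugation, both families of relations express just this multiplicativity. Commutativity of
  \<open>H\<close> takes care of the reversed factors in the first family.\<close>

lemma (in comm_group) tensor_square_lift:
  assumes "comm_group H" "\<And>h. h \<in> carrier G \<Longrightarrow> (\<lambda>g. \<beta> g h) \<in> hom G H"
    "\<And>g. g \<in> carrier G \<Longrightarrow> \<beta> g \<in> hom G H"
  obtains \<phi> where "\<phi> \<in> hom (tensor_square G) H"
    "\<And>g h. g \<in> carrier G \<Longrightarrow> h \<in> carrier G \<Longrightarrow> \<phi> (tensor G g h) = \<beta> g h"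
proof -
  interpret H: comm_group H by fact
  have closed: "\<beta> g h \<in> carrier H" if "g \<in> carrier G" "h \<in> carrier G" for g h
    using hom_in_carrier[OF assms(3)] that by blast
  have left: "\<beta> (g \<otimes> g') h = \<beta> g' h \<otimes>\<^bsub>H\<^esub> \<beta> g h"
    if "g \<in> carrier G" "g' \<in> carrier G" "h \<in> carrier G" for g g' h
    using hom_mult[OF assms(2)] that by (simp add: H.m_comm closed)
  have right: "\<beta> g (h \<otimes> h') = \<beta> g h \<otimes>\<^bsub>H\<^esub> \<beta> g h'"
    if "g \<in> carrier G" "h \<in> carrier G" "h' \<in> carrier G" for g h h'
    using hom_mult[OF assms(3)] that by simp
  have "\<exists>\<phi>\<in>hom (tensor_square G) H. \<forall>x\<in>carrier G \<times> carrier G.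
      \<phi> (word_cong (carrier G \<times> carrier G) (tensor_square_rels G) `` {[(x, True)]}) = case_prod \<beta> x"
    unfolding tensor_square_def
  proof (rule presented_group_lift)
    fix u v assume "(u, v) \<in> tensor_square_rels G"
    then show "word_eval H (case_prod \<beta>) u = word_eval H (case_prod \<beta>) v"
      by (auto simp: tensor_square_rels_def conj_act_eq left right closed)
  qed (auto simp: closed H.is_group)
  then show thesis
    by (auto simp: tensor_def intro: that)
qed

text \<open>With one argument fixed, the elements whose tensor lies in \<open>L\<close> form the
  preimage of \<open>L\<close> under a homomorphism, hence a subgroup. First the left argument is
  extended from generators to \<open>G\<close>, then the right one.\<close>

lemma (in comm_group) tensor_square_generated:
  assumes e: "e \<in> I \<rightarrow> carrier G"
    and gen: "\<And>K. subgroup K G \<Longrightarrow> e ` I \<subseteq> K \<Longrightarrow> carrier G \<subseteq> K"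
    and L: "subgroup L (tensor_square G)" "\<And>i j. i \<in> I \<Longrightarrow> j \<in> I \<Longrightarrow> tensor G (e i) (e j) \<in> L"
  shows "carrier (tensor_square G) \<subseteq> L"
proof -
  interpret T: comm_group "tensor_square G"
    by (rule comm_group_tensor_square)
  have pre: "carrier G \<subseteq> {g \<in> carrier G. f g \<in> L}"
    if f: "f \<in> hom G (tensor_square G)" and "\<And>i. i \<in> I \<Longrightarrow> f (e i) \<in> L" for f
  proof (rule gen)
    interpret f: group_hom G "tensor_square G" f
      using f by (simp add: group_hom_def group_hom_axioms_def is_group T.is_group)
    show "subgroup {g \<in> carrier G. f g \<in> L} G"
      by unfold_locales
        (auto simp: subgroup.m_closed[OF L(1)] subgroup.one_closed[OF L(1)] subgroup.m_inv_closed[OF L(1)])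
  qed (use e that in auto)
  have "tensor G g (e j) \<in> L" if "g \<in> carrier G" "j \<in> I" for g j
    using pre[OF tensor_left_hom, of "e j"] L(2) e that by auto
  then have "tensor G g h \<in> L" if "g \<in> carrier G" "h \<in> carrier G" for g h
    using pre[OF tensor_right_hom, of g] that by auto
  then have "L = carrier (tensor_square G)"
    using L(1) unfolding tensor_square_def tensor_def by (intro presented_group_subgroup_eq) auto
  then show ?thesis
    by simp
qed

section \<open>The tensor square of a direct sum of cyclic groups\<close>

lemma mod_mult_mod_gcd_left: "(a mod int m * b) mod int (gcd m k) = (a * b) mod int (gcd m k)"
  by (metis gcd_dvd1 int_dvd_int_iff mod_mod_cancel mod_mult_left_eq)

lemma mod_mult_mod_gcd_right: "(a * (b mod int k)) mod int (gcd m k) = (a * b) mod int (gcd m k)"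
  by (metis gcd_dvd2 int_dvd_int_iff mod_mod_cancel mod_mult_right_eq)

text \<open>An application of \<open>iso_cyclic_sumI\<close> to the tensors of pairs of generators:
  \<open>tensor_square_generated\<close> gives generation, \<open>int_pow_gcd\<close> the bound on
  orders, and \<open>tensor_square_lift\<close> the map to the cyclic sum.\<close>

theorem tensor_square_iso_cyclic_sum:
  assumes G: "comm_group G" and I: "finite I" and iso: "G \<cong> cyclic_sum I n"
  shows "tensor_square G \<cong> cyclic_sum (I \<times> I) (\<lambda>(i, j). gcd (n i) (n j))"
proof -
  interpret G: comm_group G by fact
  interpret T: comm_group "tensor_square G"
    by (rule G.comm_group_tensor_square)
  let ?C = "cyclic_sum I n" and ?d = "\<lambda>(i, j). gcd (n i) (n j)"
  let ?D = "cyclic_sum (I \<times> I) ?d"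
  interpret C: comm_group ?C
    by (rule comm_group_cyclic_sum[OF I])
  have II: "finite (I \<times> I)"
    using I by simp
  obtain \<theta> where \<theta>: "\<theta> \<in> iso G ?C"
    using iso by (auto simp: is_iso_def)
  then have \<theta>_hom: "\<theta> \<in> hom G ?C" and bij: "bij_betw \<theta> (carrier G) (carrier ?C)"
    by (auto simp: iso_def)
  interpret \<theta>: group_hom G ?C \<theta>
    using \<theta>_hom by (simp add: group_hom_def group_hom_axioms_def G.is_group C.is_group)
  define e where "e i = inv_into (carrier G) \<theta> (cyclic_unit I n i)" for i
  have e: "e i \<in> carrier G" and \<theta>_e: "\<theta> (e i) = cyclic_unit I n i" for i
    unfolding e_def using cyclic_unit_carrier[OF I] bij
    by (auto simp: bij_betw_def inv_into_into f_inv_into_f)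
  \<comment> \<open>The image of \<open>K\<close> contains the standard generators and so is all of
    \<open>?C\<close>; injectivity of \<open>\<theta>\<close> carries this back to
    \<open>G\<close>.\<close>
  have gen: "carrier G \<subseteq> K" if K: "subgroup K G" "e ` I \<subseteq> K" for K
  proof -
    have "\<theta> ` K = carrier ?C"
      using K(2) by (intro subgroup_cyclic_sum_eq[OF I \<theta>.subgroup_img_is_subgroup[OF K(1)]])
        (auto simp flip: \<theta>_e)
    then have "\<theta> ` K = \<theta> ` carrier G"
      using bij by (simp add: bij_betw_def)
    moreover have "inj_on \<theta> (carrier G)"
      using bij by (simp add: bij_betw_def)
    ultimately show ?thesis
      using inj_on_image_eq_iff[of \<theta> "carrier G" K "carrier G"] subgroup.subset[OF K(1)] by simp
  qed
  have e_pow: "e i [^]\<^bsub>G\<^esub> int (n i) = \<one>\<^bsub>G\<^esub>" if i: "i \<in> I" for i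
  proof (rule inj_onD)
    show "inj_on \<theta> (carrier G)"
      using bij by (simp add: bij_betw_def)
    show "\<theta> (e i [^]\<^bsub>G\<^esub> int (n i)) = \<theta> \<one>\<^bsub>G\<^esub>"
      by (simp add: \<theta>.hom_int_pow e \<theta>_e cyclic_unit_pow[OF I i])
  qed (simp_all add: e)
  \<comment> \<open>All products of a coordinate of \<open>g\<close> with a coordinate of
    \<open>h\<close>. The modulus divides both \<open>n i\<close> and \<open>n j\<close>, so
    reducing coordinates of \<open>\<theta>\<close> does not affect the value, and
    \<open>\<beta>\<close> is additive in each argument.\<close>
  define \<beta> where "\<beta> g h = (\<lambda>(i, j)\<in>I \<times> I. (\<theta> g i * \<theta> h j) mod int (?d (i, j)))" for g h
  have \<theta>_mult: "\<theta> (g \<otimes>\<^bsub>G\<^esub> g') i = (\<theta> g i + \<theta> g' i) mod int (n i)"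
    if "g \<in> carrier G" "g' \<in> carrier G" "i \<in> I" for g g' i
    using that by (simp add: mult_cyclic_sum)
  have \<beta>_closed: "\<beta> g h \<in> carrier ?D" for g h
    by (auto simp: \<beta>_def carrier_cyclic_sum[OF II] mod_carrier_integer_mod_group)
  have left: "(\<lambda>g. \<beta> g h) \<in> hom G ?D" if h: "h \<in> carrier G" for h
  proof (rule homI)
    show "\<beta> (g \<otimes>\<^bsub>G\<^esub> g') h = \<beta> g h \<otimes>\<^bsub>?D\<^esub> \<beta> g' h"
      if "g \<in> carrier G" "g' \<in> carrier G" for g g'
      using that h by (auto simp: \<beta>_def \<theta>_mult mult_cyclic_sum fun_eq_iff
          mod_mult_mod_gcd_left mod_add_eq distrib_right simp del: \<theta>.hom_mult)
  qed (rule \<beta>_closed)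
  have right: "\<beta> g \<in> hom G ?D" if g: "g \<in> carrier G" for g
  proof (rule homI)
    show "\<beta> g (h \<otimes>\<^bsub>G\<^esub> h') = \<beta> g h \<otimes>\<^bsub>?D\<^esub> \<beta> g h'"
      if "h \<in> carrier G" "h' \<in> carrier G" for h h'
      using that g by (auto simp: \<beta>_def \<theta>_mult mult_cyclic_sum fun_eq_iff
          mod_mult_mod_gcd_right mod_add_eq distrib_left simp del: \<theta>.hom_mult)
  qed (rule \<beta>_closed)
  obtain \<phi> where \<phi>: "\<phi> \<in> hom (tensor_square G) ?D"
    "\<And>g h. g \<in> carrier G \<Longrightarrow> h \<in> carrier G \<Longrightarrow> \<phi> (tensor G g h) = \<beta> g h"
    using G.tensor_square_lift[OF comm_group_cyclic_sum[OF II] left right] by blast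
  have "\<phi> \<in> iso (tensor_square G) ?D"
  proof (rule iso_cyclic_sumI[OF T.comm_group_axioms II, where t = "\<lambda>(i, j). tensor G (e i) (e j)"])
    show "carrier (tensor_square G) \<subseteq> L"
      if "subgroup L (tensor_square G)" "(\<lambda>(i, j). tensor G (e i) (e j)) ` (I \<times> I) \<subseteq> L" for L
      using that e gen by (intro G.tensor_square_generated[of e I]) auto
    \<comment> \<open>The coordinates of \<open>e i\<close> and \<open>e j\<close> vanish away from
      \<open>i\<close> and \<open>j\<close>, so only entry \<open>(i, j)\<close> of the product can
      survive; there the value is \<open>1\<close> modulo the gcd.\<close>
    show "\<phi> (case x of (i, j) \<Rightarrow> tensor G (e i) (e j)) = cyclic_unit (I \<times> I) ?d x" if "x \<in> I \<times> I" for x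
      using that by (auto simp: \<phi>(2) e \<beta>_def \<theta>_e cyclic_unit_def fun_eq_iff
          mod_mult_mod_gcd_left mod_mod_cancel split: if_splits)
    show "(case x of (i, j) \<Rightarrow> tensor G (e i) (e j)) [^]\<^bsub>tensor_square G\<^esub> int (?d x) = \<one>\<^bsub>tensor_square G\<^esub>"
      if "x \<in> I \<times> I" for x
    proof -
      from that obtain i j where x: "x = (i, j)" "i \<in> I" "j \<in> I"
        by auto
      \<comment> \<open>The order bound of \<open>e i\<close> passes through the homomorphism in the
        left argument, that of \<open>e j\<close> through the one in the right argument.\<close>
      have "tensor G (e i) (e j) [^]\<^bsub>tensor_square G\<^esub> int (n i) = \<one>\<^bsub>tensor_square G\<^esub>"
        using hom_int_pow[OF G.tensor_left_hom[OF e[of j]] e[of i] G.is_group T.is_group, of "int (n i)"]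
          hom_one[OF G.tensor_left_hom[OF e[of j]] G.is_group T.is_group] x
        by (simp add: e_pow)
      moreover have "tensor G (e i) (e j) [^]\<^bsub>tensor_square G\<^esub> int (n j) = \<one>\<^bsub>tensor_square G\<^esub>"
        using hom_int_pow[OF G.tensor_right_hom[OF e[of i]] e[of j] G.is_group T.is_group, of "int (n j)"]
          hom_one[OF G.tensor_right_hom[OF e[of i]] G.is_group T.is_group] x
        by (simp add: e_pow)
      ultimately show ?thesis
        using T.int_pow_gcd[OF tensor_closed[OF e e], of i j "int (n i)" "int (n j)"] x by simp
    qed
  qed (use \<phi>(1) e in \<open>auto intro: tensor_closed\<close>)
  then show ?thesis
    by (rule is_isoI)
qed

text \<open>\<open>List.product\<close> lists pairs row by row, so position \<open>l\<close> holds
  the pair with indices \<open>l div length ns\<close> and \<open>l mod length ns\<close>.\<close>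

lemma tensor_square_iso_cyclic_list:
  assumes "comm_group G" "G \<cong> cyclic_list ns"
  shows "tensor_square G \<cong> cyclic_list (map (\<lambda>(a, b). gcd a b) (List.product ns ns))"
proof -
  let ?k = "length ns" and ?f = "\<lambda>l. (l div length ns, l mod length ns)"
  have "tensor_square G \<cong> cyclic_sum ({..<?k} \<times> {..<?k}) (\<lambda>(i, j). gcd (ns ! i) (ns ! j))"
    using assms by (intro tensor_square_iso_cyclic_sum) (simp_all add: cyclic_list_def)
  also have "\<dots> \<cong> cyclic_list (map (\<lambda>(a, b). gcd a b) (List.product ns ns))"
    unfolding cyclic_list_def
  proof (rule cyclic_sum_reindex)
    show "bij_betw ?f {..<length (map (\<lambda>(a, b). gcd a b) (List.product ns ns))} ({..<?k} \<times> {..<?k})"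
    proof (rule bij_betw_byWitness[where f' = "\<lambda>(i, j). i * ?k + j"])
      show "(\<lambda>(i, j). i * ?k + j) ` ({..<?k} \<times> {..<?k}) \<subseteq> {..<length (map (\<lambda>(a, b). gcd a b) (List.product ns ns))}"
      proof clarsimp
        fix i j assume "i < ?k" "j < ?k"
        then have "i * ?k + j < Suc i * ?k" "Suc i * ?k \<le> ?k * ?k"
          by (simp, intro mult_le_mono1) simp
        then show "i * ?k + j < ?k * ?k"
          by linarith
      qed
      show "\<forall>x\<in>{..<?k} \<times> {..<?k}. ?f (case x of (i, j) \<Rightarrow> i * ?k + j) = x"
        \<comment> \<open>An empty list leaves no pairs to check; otherwise \<open>?k\<close> is
          positive and division with remainder recovers \<open>i\<close> and
          \<open>j\<close>.\<close>
        by (cases "ns = []") auto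
    qed (auto simp: less_mult_imp_div_less intro!: mod_less_divisor)
  qed (auto simp: product_nth less_mult_imp_div_less)
  finally show ?thesis .
qed

text \<open>Once lists of orders for \<open>G\<close> and \<open>H\<close> are known, what remains
  is to count the gcds of ordered pairs.\<close>

lemma tensor_square_isoI:
  assumes "comm_group G" "group H" "G \<cong> cyclic_list ns" "H \<cong> cyclic_list ms"
    and ms: "mset (map (\<lambda>(a, b). gcd a b) (List.product ns ns)) = mset ms"
  shows "tensor_square G \<cong> H"
proof -
  have "tensor_square G \<cong> cyclic_list (map (\<lambda>(a, b). gcd a b) (List.product ns ns))"
    using assms(1,3) by (rule tensor_square_iso_cyclic_list)
  also have "\<dots> \<cong> cyclic_list ms"
    using ms[symmetric] by (rule cyclic_list_mset_cong)
  also have "\<dots> \<cong> H"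
    using assms(2,4) by (rule group.iso_sym)
  finally show ?thesis .
qed

section \<open>Counting gcds for the seven groups\<close>

lemma group_copies_Z: "group (copies k (Z n))"
  by (simp add: copies_def)

lemma gcd_power_power: "gcd (p ^ a) (p ^ b) = (p::nat) ^ min a b"
  by (cases a b rule: linorder_le_cases) (simp_all add: gcd_nat.absorb1 gcd_nat.absorb2 le_imp_power_dvd)

text \<open>The summand \<open>Z p\<close> has its order written \<open>p\<close>, not
  \<open>p ^ 1\<close>, so gcds with \<open>p\<close> need rules of their own.\<close>

lemma gcd_power_self:
  "0 < a \<Longrightarrow> gcd (p ^ a) p = (p::nat)" "0 < a \<Longrightarrow> gcd p (p ^ a) = (p::nat)"
  by (simp_all add: gcd_nat.absorb1 gcd_nat.absorb2 dvd_power)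

text \<open>Each rule fits one shape of group expression, so repeated use reads off the list of
  orders from the expression.\<close>

lemmas iso_cyclic_list_intros =
  Z_iso_cyclic_list copies_iso_cyclic_list DirProd_iso_cyclic_list
  group_integer_mod_group group_copies_Z DirProd_group

theorem theorem4p6:
  fixes G :: "('a, 'b) monoid_scheme" and p :: nat
  assumes "Factorial_Ring.prime p" and "p > 3"
    and "comm_group G" and "Coset.order G dvd p ^ 5"
  shows
    "(G \<cong> Z (p ^ 5) \<longrightarrow>
        tensor_square G \<cong> Z (p ^ 5)) \<and>
     (G \<cong> Z (p ^ 3) \<times>\<times> Z (p ^ 2) \<longrightarrow>
        tensor_square G \<cong> Z (p ^ 3) \<times>\<times> copies 3 (Z (p ^ 2))) \<and>
     (G \<cong> Z (p ^ 4) \<times>\<times> Z p \<longrightarrow>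
        tensor_square G \<cong> Z (p ^ 4) \<times>\<times> copies 3 (Z p)) \<and>
     (G \<cong> Z (p ^ 2) \<times>\<times> Z (p ^ 2) \<times>\<times> Z p \<longrightarrow>
        tensor_square G \<cong> copies 4 (Z (p ^ 2)) \<times>\<times> copies 5 (Z p)) \<and>
     (G \<cong> Z (p ^ 3) \<times>\<times> Z p \<times>\<times> Z p \<longrightarrow>
        tensor_square G \<cong> Z (p ^ 3) \<times>\<times> copies 8 (Z p)) \<and>
     (G \<cong> Z (p ^ 2) \<times>\<times> Z p \<times>\<times> Z p \<times>\<times> Z p \<longrightarrow>
        tensor_square G \<cong> Z (p ^ 2) \<times>\<times> copies 15 (Z p)) \<and>
     (G \<cong> copies 5 (Z p) \<longrightarrow>
        tensor_square G \<cong> copies 25 (Z p))"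
proof (intro conjI impI)
  assume G: "G \<cong> Z (p ^ 5)"
  show "tensor_square G \<cong> Z (p ^ 5)"
    by (rule tensor_square_isoI[OF assms(3) _ iso_trans[OF G]], (rule iso_cyclic_list_intros)+) simp
next
  assume G: "G \<cong> Z (p ^ 3) \<times>\<times> Z (p ^ 2)"
  \<comment> \<open>Of the four ordered pairs of orders, only one avoids
    \<open>p ^ 2\<close>.\<close>
  show "tensor_square G \<cong> Z (p ^ 3) \<times>\<times> copies 3 (Z (p ^ 2))"
    by (rule tensor_square_isoI[OF assms(3) _ iso_trans[OF G]], (rule iso_cyclic_list_intros)+)
      (simp add: gcd_power_power, simp add: numeral_eq_Suc)
next
  assume G: "G \<cong> Z (p ^ 4) \<times>\<times> Z p"
  show "tensor_square G \<cong> Z (p ^ 4) \<times>\<times> copies 3 (Z p)"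
    by (rule tensor_square_isoI[OF assms(3) _ iso_trans[OF G]], (rule iso_cyclic_list_intros)+)
      (simp add: gcd_power_self, simp add: numeral_eq_Suc)
next
  assume G: "G \<cong> Z (p ^ 2) \<times>\<times> Z (p ^ 2) \<times>\<times> Z p"
  \<comment> \<open>Four of the nine ordered pairs consist of two entries \<open>p ^ 2\<close>; the
    other five contain \<open>p\<close>.\<close>
  show "tensor_square G \<cong> copies 4 (Z (p ^ 2)) \<times>\<times> copies 5 (Z p)"
    by (rule tensor_square_isoI[OF assms(3) _ iso_trans[OF G]], (rule iso_cyclic_list_intros)+)
      (simp add: gcd_power_self, simp add: numeral_eq_Suc)
next
  assume G: "G \<cong> Z (p ^ 3) \<times>\<times> Z p \<times>\<times> Z p"
  show "tensor_square G \<cong> Z (p ^ 3) \<times>\<times> copies 8 (Z p)"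
    by (rule tensor_square_isoI[OF assms(3) _ iso_trans[OF G]], (rule iso_cyclic_list_intros)+)
      (simp add: gcd_power_self, simp add: numeral_eq_Suc)
next
  assume G: "G \<cong> Z (p ^ 2) \<times>\<times> Z p \<times>\<times> Z p \<times>\<times> Z p"
  \<comment> \<open>Of the sixteen ordered pairs, all but one contain \<open>p\<close>.\<close>
  show "tensor_square G \<cong> Z (p ^ 2) \<times>\<times> copies 15 (Z p)"
    by (rule tensor_square_isoI[OF assms(3) _ iso_trans[OF G]], (rule iso_cyclic_list_intros)+)
      (simp add: gcd_power_self, simp add: numeral_eq_Suc)
next
  assume G: "G \<cong> copies 5 (Z p)"
  show "tensor_square G \<cong> copies 25 (Z p)"
    by (rule tensor_square_isoI[OF assms(3) _ iso_trans[OF G]], (rule iso_cyclic_list_intros)+)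
      (simp add: numeral_eq_Suc)
qed

end
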